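(* The double integral operator $\mathfrak{E}_{\gamma_{4},\gamma_{5},\gamma_{6};p;q;\upsilon;w_{1},w_{2};a_{1}^{+},b_{1}^{+}}^{(\gamma_{1};\gamma_{2};\gamma_{3})}$ is bounded in the space $C([a_1,a_2]\times[b_1,b_2])$, i.e. $$\left\|\mathfrak{E}_{\gamma_{4},\gamma_{5},\gamma_{6};p;q;\upsilon;w_{1},w_{2};a_{1}^{+},b_{1}^{+}}^{(\gamma_{1};\gamma_{2};\gamma_{3})}d\right\|_{C}\le\mathcal{M}\,\|d\|_{C},$$ where $$\mathcal{M}=(a_{2}-b_{1})^{\operatorname{Re}(p)}(b_{2}-a_{1})^{\operatorname{Re}(q)}\sum_{n=0}^{\infty}\sum_{l=0}^{\infty}\frac{|(\gamma_{1})_{2l}|\,|(\gamma_{2})_{l+n}|\,|(\gamma_{3})_{l}|}{|(\gamma_{4})_{l}|\,|(\gamma_{5})_{l}|\,|(\gamma_{6})_{l}|}\times\frac{|w_{1}(a_{2}-b_{1})|^{l}\,|w_{2}(b_{2}-a_{1})|^{\upsilon n}}{|\Gamma(p+l)|\,|\Gamma(q+\upsilon n)|\,(\operatorname{Re}(p)+l)\,(\operatorname{Re}(q)+\upsilon n)\,l!\,n!}<\infty.$$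
   Context: $(a)_n$ is the Pochhammer symbol. For $p,q,\upsilon,\gamma_1,\gamma_2,\gamma_3,\gamma_4,\gamma_5,\gamma_6\in\mathbb{C}$ with $\operatorname{Re}(p)>0$, $\operatorname{Re}(q)>0$, $\operatorname{Re}(\upsilon)>0$ and $\gamma_4,\gamma_5,\gamma_6\notin\mathbb{Z}^{-}\cup\{0\}$, the modified bivariate I-Konhauser Mittag-Leffler function is $$E_{\gamma_{4},\gamma_{5},\gamma_{6};p;q;\upsilon}^{(\gamma_{1};\gamma_{2};\gamma_{3})}(z,t)=\sum_{l=0}^{\infty}\sum_{n=0}^{\infty}\frac{(-1)^{l}(\gamma_{1})_{2l}(\gamma_{2})_{l+n}(\gamma_{3})_{l}\,z^{l}t^{\upsilon n}}{(\gamma_{4})_{l}(\gamma_{5})_{l}(\gamma_{6})_{l}\,\Gamma(p+l)\,\Gamma(q+\upsilon n)\,n!\,l!}.$$ With parameters $w_1,w_2$, the double integral operator is $$\left(\mathfrak{E}_{\gamma_{4},\gamma_{5},\gamma_{6};p;q;\upsilon;w_{1},w_{2};a_{1}^{+},b_{1}^{+}}^{(\gamma_{1};\gamma_{2};\gamma_{3})}d\right)(z,t)=\int_{b_1}^{t}\int_{a_1}^{z}(t-y)^{q-1}(z-\xi)^{p-1}E_{\gamma_{4},\gamma_{5},\gamma_{6};p;q;\upsilon}^{(\gamma_{1};\gamma_{2};\gamma_{3})}\left(w_{1}(z-\xi),w_{2}(t-y)\right)d(\xi,y)\,d\xi\,dy.$$ $C([a_1,a_2]\times[b_1,b_2])$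 is the space of continuous functions on $[a_1,a_2]\times[b_1,b_2]$ with the max norm $\|h\|_{C}=\max_{a_1\le z\le a_2,\ b_1\le t\le b_2}|h(z,t)|$.
   Formalization: In M, a2−b1 and b2−a1 are replaced by a2−a1 and b2−b1 (as printed the bound fails, e.g. E=1, d=1 on [0,1]×[1,2]); for non-real υ, where M is not real, |w2(b2−a1)|^{υn} is read as |(w2(b2−b1))^υ|^n and Re(q)+υn as Re(q)+Re(υ)n. *)

theory Defs
  imports "HOL-Analysis.Analysis"
begin

text \<open>
  The power \<open>t\<^sup>\<upsilon>\<^sup>n\<close> is written \<open>(t powr \<upsilon>) ^ n\<close> rather than \<open>t powr (\<upsilon> * n)\<close>: the two agree
  (principal branch) for \<open>t \<noteq> 0\<close>, but HOL has \<open>0 powr 0 = 0\<close>, so the latter would lose the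
  terms with \<open>n = 0\<close> at \<open>t = 0\<close>.
\<close>
definition IKML ::
  "complex \<Rightarrow> complex \<Rightarrow> complex \<Rightarrow> complex \<Rightarrow> complex \<Rightarrow> complex \<Rightarrow>
   complex \<Rightarrow> complex \<Rightarrow> complex \<Rightarrow> complex \<Rightarrow> complex \<Rightarrow> complex"
where
  "IKML \<gamma>1 \<gamma>2 \<gamma>3 \<gamma>4 \<gamma>5 \<gamma>6 p q \<upsilon> z t =
     (\<Sum>l. \<Sum>n.
        ((-1) ^ l * pochhammer \<gamma>1 (2 * l) * pochhammer \<gamma>2 (l + n) * pochhammer \<gamma>3 l
           * z ^ l * (t powr \<upsilon>) ^ n)
        / (pochhammer \<gamma>4 l * pochhammer \<gamma>5 l * pochhammer \<gamma>6 l
           * Gamma (p + of_nat l) * Gamma (q + \<upsilon> * of_nat n) * fact n * fact l))"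

definition IKML_integrand ::
  "complex \<Rightarrow> complex \<Rightarrow> complex \<Rightarrow> complex \<Rightarrow> complex \<Rightarrow> complex \<Rightarrow>
   complex \<Rightarrow> complex \<Rightarrow> complex \<Rightarrow> complex \<Rightarrow> complex \<Rightarrow>
   (real \<times> real \<Rightarrow> complex) \<Rightarrow> real \<Rightarrow> real \<Rightarrow> real \<Rightarrow> real \<Rightarrow> complex"
where
  "IKML_integrand \<gamma>1 \<gamma>2 \<gamma>3 \<gamma>4 \<gamma>5 \<gamma>6 p q \<upsilon> w1 w2 d z t y \<xi> =
     complex_of_real (t - y) powr (q - 1) * complex_of_real (z - \<xi>) powr (p - 1)
     * IKML \<gamma>1 \<gamma>2 \<gamma>3 \<gamma>4 \<gamma>5 \<gamma>6 p q \<upsilon>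
         (w1 * complex_of_real (z - \<xi>)) (w2 * complex_of_real (t - y))
     * d (\<xi>, y)"

definition IKML_op ::
  "complex \<Rightarrow> complex \<Rightarrow> complex \<Rightarrow> complex \<Rightarrow> complex \<Rightarrow> complex \<Rightarrow>
   complex \<Rightarrow> complex \<Rightarrow> complex \<Rightarrow> complex \<Rightarrow> complex \<Rightarrow> real \<Rightarrow> real \<Rightarrow>
   (real \<times> real \<Rightarrow> complex) \<Rightarrow> (real \<times> real \<Rightarrow> complex)"
where
  "IKML_op \<gamma>1 \<gamma>2 \<gamma>3 \<gamma>4 \<gamma>5 \<gamma>6 p q \<upsilon> w1 w2 a1 b1 d =
     (\<lambda>(z, t). LBINT y:{b1..t}. LBINT \<xi>:{a1..z}.
        IKML_integrand \<gamma>1 \<gamma>2 \<gamma>3 \<gamma>4 \<gamma>5 \<gamma>6 p q \<upsilon> w1 w2 d z t y \<xi>)"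

definition normC :: "(real \<times> real) set \<Rightarrow> (real \<times> real \<Rightarrow> complex) \<Rightarrow> real" where
  "normC R h = (SUP x\<in>R. norm (h x))"

text \<open>On continuous functions over a nonempty compact set the supremum is a maximum.\<close>
lemma normC_max:
  assumes "compact R" "R \<noteq> {}" "continuous_on R h"
  shows "\<exists>x\<in>R. normC R h = norm (h x) \<and> (\<forall>y\<in>R. norm (h y) \<le> norm (h x))"
proof -
  have "continuous_on R (\<lambda>x. norm (h x))"
    using assms(3) by (rule continuous_on_norm)
  then obtain x where x: "x \<in> R" "\<forall>y\<in>R. norm (h y) \<le> norm (h x)"
    using continuous_attains_sup[OF assms(1,2)] by blast
  have "normC R h = norm (h x)"
    unfolding normC_def using x by (intro cSup_eq_maximum) auto
  with x show ?thesis by blast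
qed

text \<open>
  The constant of the bound for a rectangle with sides \<open>A\<close>, \<open>B\<close>. It lives in \<open>ennreal\<close>, so that
  the double series is always meaningful and its convergence is the statement that the constant
  is below \<open>\<infinity>\<close>. For complex \<open>\<upsilon>\<close> the modulus is taken after raising to the power \<open>\<upsilon>\<close>, and
  \<open>Re \<upsilon>\<close> appears in the last factor; for real \<open>\<upsilon>\<close> this is
  \<open>\<bar>w2 B\<bar>\<^sup>\<upsilon>\<^sup>n / (Re q + \<upsilon> n)\<close>, since then \<open>norm (w powr \<upsilon>) = norm w powr Re \<upsilon>\<close>.
\<close>
definition IKML_bound ::
  "complex \<Rightarrow> complex \<Rightarrow> complex \<Rightarrow> complex \<Rightarrow> complex \<Rightarrow> complex \<Rightarrow>
   complex \<Rightarrow> complex \<Rightarrow> complex \<Rightarrow> complex \<Rightarrow> complex \<Rightarrow> real \<Rightarrow> real \<Rightarrow> ennreal"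
where
  "IKML_bound \<gamma>1 \<gamma>2 \<gamma>3 \<gamma>4 \<gamma>5 \<gamma>6 p q \<upsilon> w1 w2 A B =
     ennreal (A powr Re p * B powr Re q) *
     (\<Sum>n. \<Sum>l. ennreal (
        (norm (pochhammer \<gamma>1 (2 * l)) * norm (pochhammer \<gamma>2 (l + n)) * norm (pochhammer \<gamma>3 l))
        / (norm (pochhammer \<gamma>4 l) * norm (pochhammer \<gamma>5 l) * norm (pochhammer \<gamma>6 l))
        * ((norm (w1 * complex_of_real A) ^ l
             * norm ((w2 * complex_of_real B) powr \<upsilon>) ^ n)
           / (norm (Gamma (p + of_nat l)) * norm (Gamma (q + \<upsilon> * of_nat n))
              * (Re p + real l) * (Re q + Re \<upsilon> * real n) * fact l * fact n))))"

end

theory Submission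
  imports Defs
begin

text \<open>
  Write \<open>E(z, t) = (\<Sum>l. \<Sum>n. c l n * z ^ l * (t powr \<upsilon>) ^ n)\<close> for the Mittag-Leffler function. Two
  independent facts make the operator bounded.

  The first is that the double series is dominated by a product of two entire power series. The
  Pochhammer symbols in the coefficient compare with factorials up to geometric factors
  (\<open>norm_pochhammer_le\<close>, \<open>norm_pochhammer_ge\<close>), and \<open>(2 * l)!\<close> and \<open>(l + n)!\<close> split into
  \<open>(l!)\<^sup>2\<close> and \<open>l! * n!\<close> at a geometric cost (\<open>fact_add_le\<close>). What remains is
  \<open>norm (c l n) \<le> P l * Q n\<close> with \<open>P l\<close> of order \<open>K ^ l / l!\<close> and \<open>Q n\<close> of order
  \<open>K ^ n / \<bar>\<Gamma> (q + \<upsilon> * n)\<bar>\<close>. Since \<open>\<upsilon>\<close> is complex, the argument of \<open>\<Gamma>\<close> runs along a slanted line in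
  the right half plane. Leaving the real axis costs a factor \<open>exp (pi / 2 * \<bar>Im\<bar>)\<close> at most
  (\<open>norm_rGamma_le\<close>), which is geometric in \<open>n\<close>, whereas \<open>\<Gamma>\<close> grows faster than any exponential on
  the real axis (\<open>rGamma_real_le\<close>); hence \<open>Q\<close> beats every geometric sequence
  (\<open>summable_rGamma_arith_progression\<close>). This makes the constant finite, and by uniform
  convergence it makes \<open>(u, v) \<mapsto> E(w1 * u, w2 * v)\<close> continuous up to the boundary \<open>v = 0\<close>.

  The second is that the powers \<open>(z - \<xi>) powr (p - 1)\<close> and \<open>(t - y) powr (q - 1)\<close> are integrable
  singularities. An integral of such a kernel against a continuous factor depends continuously on
  parameters by dominated convergence (\<open>continuous_on_parametric_integral\<close>). The domain of
  integration depends on \<open>(z, t)\<close>, but rescaling it to the unit square pulls out the factor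
  \<open>(z - a1) powr p * (t - b1) powr q\<close> and leaves a parametric integral over a fixed domain
  (\<open>powr_kernel_integral_rescale\<close>); this gives continuity of the image.

  For the norm estimate, all integrals and sums are moved to the extended nonnegative reals, where
  they commute freely. Integrating termwise,
  \<open>(z - \<xi>) powr (Re p - 1) * (z - \<xi>) ^ l\<close> contributes \<open>(z - a1) powr (Re p + l) / (Re p + l)\<close>, and
  likewise in the other variable; enlarging \<open>z - a1\<close> and \<open>t - b1\<close> to the sides of the rectangle
  yields the stated constant (\<open>double_powr_kernel_bound\<close>, \<open>norm_IKML_op_le\<close>).
\<close>

section \<open>Growth of Pochhammer symbols and of the reciprocal Gamma function\<close>

text \<open>
  Each factor satisfies \<open>norm (z + k) \<le> norm z + k \<le> (norm z + 1) * (k + 1)\<close>.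
\<close>
lemma norm_pochhammer_le:
  fixes z :: "'a :: real_normed_field"
  shows "norm (pochhammer z n) \<le> (norm z + 1) ^ n * fact n"
proof (induction n)
  case (Suc n)
  have "norm (z + of_nat n) \<le> norm z + real n"
    using norm_triangle_ineq[of z "of_nat n"] by simp
  also have "\<dots> \<le> (norm z + 1) * real (Suc n)"
    by (simp add: algebra_simps)
  finally have "norm (pochhammer z n) * norm (z + of_nat n)
      \<le> ((norm z + 1) ^ n * fact n) * ((norm z + 1) * real (Suc n))"
    by (intro mult_mono Suc.IH) auto
  thus ?case by (simp only: pochhammer_Suc norm_mult fact_Suc power_Suc) (simp add: mult_ac)
qed simp

text \<open>
  No factor \<open>z + k\<close> vanishes and \<open>norm (z + k) / (k + 1)\<close> tends to \<open>1\<close>, so this ratio has a positive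
  lower bound \<open>c\<close>. Such a bound turns Pochhammer symbols in denominators into factorials.
\<close>
lemma norm_pochhammer_ge:
  fixes z :: complex
  assumes "z \<notin> \<int>\<^sub>\<le>\<^sub>0"
  obtains c where "c > 0" "\<And>n. c ^ n * fact n \<le> norm (pochhammer z n)"
proof -
  \<comment> \<open>From \<open>k = N\<close> on the ratio is at least \<open>1/2\<close>; the finitely many earlier ones are taken into the minimum.\<close>
  define N where "N = nat \<lceil>2 * norm z + 1\<rceil>"
  define c where "c = Min (insert (1/2) ((\<lambda>k. norm (z + of_nat k) / real (Suc k)) ` {..<N}))"
  have nz: "z + of_nat k \<noteq> 0" for k
    using assms by (metis add_eq_0_iff minus_of_nat_in_nonpos_Ints add.commute)
  have "c > 0" unfolding c_def using nz by (subst Min_gr_iff) auto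
  have step: "c * real (Suc k) \<le> norm (z + of_nat k)" for k
  proof (cases "k < N")
    case True
    hence "c \<le> norm (z + of_nat k) / real (Suc k)"
      unfolding c_def by (intro Min_le) auto
    thus ?thesis by (simp add: field_simps)
  next
    case False
    hence k: "real k \<ge> 2 * norm z + 1" unfolding N_def by linarith
    have "c \<le> 1/2" unfolding c_def by (intro Min_le) auto
    hence "c * real (Suc k) \<le> 1/2 * real (Suc k)" by (intro mult_right_mono) auto
    also have "\<dots> \<le> real k - norm z" using k by simp
    also have "\<dots> \<le> norm (z + of_nat k)"
      using norm_triangle_ineq2[of "of_nat k" "- z"] by (simp add: add.commute)
    finally show ?thesis .
  qed
  have "c ^ n * fact n \<le> norm (pochhammer z n)" for n
  proof (induction n)
    case (Suc n)
    have "(c ^ n * fact n) * (c * real (Suc n)) \<le> norm (pochhammer z n) * norm (z + of_nat n)"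
      using \<open>c > 0\<close> by (intro mult_mono Suc.IH step) auto
    thus ?case by (simp only: pochhammer_Suc norm_mult fact_Suc power_Suc) (simp add: mult_ac)
  qed simp
  with \<open>c > 0\<close> show ?thesis using that by blast
qed

lemma fact_add_le: "(fact (m + n) :: real) \<le> 2 ^ (m + n) * fact m * fact n"
proof -
  have "real ((m + n) choose m) \<le> 2 ^ (m + n)"
    using binomial_le_pow2[of "m + n" m] by (metis of_nat_le_iff of_nat_numeral of_nat_power)
  thus ?thesis by (simp add: binomial_fact field_simps)
qed

text \<open>
  Along vertical lines, \<open>\<bar>\<Gamma>\<bar>\<close> decays faster the further left the line lies: in Euler's product, the quotient
  \<open>\<bar>\<Gamma> (x + i y)\<bar> / \<Gamma> x\<close> is the product of \<open>(1 + y\<^sup>2 / (x + k)\<^sup>2) powr (-1/2)\<close> over all \<open>k\<close> and thus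
  increases with \<open>x\<close>. It therefore suffices to know it on the line \<open>x = 1/2\<close>, where the reflection
  formula evaluates \<open>\<Gamma> (1/2 + i y) * \<Gamma> (1/2 - i y)\<close> explicitly.
\<close>
lemma norm_rGamma_le:
  fixes z :: complex
  assumes "Re z \<ge> 1/2"
  shows "norm (rGamma z) \<le> exp (pi / 2 * \<bar>Im z\<bar>) * rGamma (Re z)"
proof -
  define w where "w = Complex (1/2) (Im z)"
  have poch: "norm (pochhammer z n) * pochhammer (1/2) n \<le> pochhammer (Re z) n * norm (pochhammer w n)" for n
  proof (induction n)
    case (Suc n)
    define x y k where "x = Re z" "y = Im z" "k = real n"
    have x: "x \<ge> 1/2" "k \<ge> 0" using assms by (auto simp: x_y_k_def)
    have "((x + k)\<^sup>2 + y\<^sup>2) * (1/2 + k)\<^sup>2 \<le> (x + k)\<^sup>2 * ((1/2 + k)\<^sup>2 + y\<^sup>2)"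
    proof -
      have "(1/2 + k)\<^sup>2 \<le> (x + k)\<^sup>2" using x by (intro power_mono) auto
      hence "y\<^sup>2 * (1/2 + k)\<^sup>2 \<le> y\<^sup>2 * (x + k)\<^sup>2" by (intro mult_left_mono) auto
      thus ?thesis by (simp add: algebra_simps)
    qed
    hence "sqrt (((x + k)\<^sup>2 + y\<^sup>2) * (1/2 + k)\<^sup>2) \<le> sqrt ((x + k)\<^sup>2 * ((1/2 + k)\<^sup>2 + y\<^sup>2))"
      by simp
    hence "norm (z + of_nat n) * (1/2 + real n) \<le> (Re z + real n) * norm (w + of_nat n)"
      using x unfolding x_y_k_def by (simp add: real_sqrt_mult cmod_def w_def)
    moreover have "pochhammer (Re z) n \<ge> 0" "pochhammer (1/2::real) n \<ge> 0"
      using assms by (auto intro: pochhammer_nonneg)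
    ultimately have "(norm (pochhammer z n) * pochhammer (1/2) n) * (norm (z + of_nat n) * (1/2 + real n))
       \<le> (pochhammer (Re z) n * norm (pochhammer w n)) * ((Re z + real n) * norm (w + of_nat n))"
      using assms by (intro mult_mono[OF Suc.IH]) auto
    thus ?case by (simp only: pochhammer_Suc norm_mult) (simp add: mult_ac)
  qed simp
  have "norm (rGamma_series z n) * rGamma_series (1/2) n
      \<le> rGamma_series (Re z) n * norm (rGamma_series w n)" for n
  proof -
    have "norm (rGamma_series z n) * rGamma_series (1/2) n
      = norm (pochhammer z (Suc n)) * pochhammer (1/2) (Suc n) /
          (fact n * exp (Re z * ln (real n)) * (fact n * exp (1/2 * ln (real n))))"
      by (simp add: rGamma_series_def norm_divide norm_mult)
    also have "\<dots> \<le> pochhammer (Re z) (Suc n) * norm (pochhammer w (Suc n)) /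
          (fact n * exp (Re z * ln (real n)) * (fact n * exp (1/2 * ln (real n))))"
      by (intro divide_right_mono poch) auto
    also have "\<dots> = rGamma_series (Re z) n * norm (rGamma_series w n)"
      by (simp add: rGamma_series_def norm_divide norm_mult w_def)
    finally show ?thesis .
  qed
  hence le: "norm (rGamma z) * rGamma (1/2) \<le> rGamma (Re z) * norm (rGamma w)"
    by (intro LIMSEQ_le[OF tendsto_mult[OF tendsto_norm[OF rGamma_series_LIMSEQ] rGamma_series_LIMSEQ]
          tendsto_mult[OF rGamma_series_LIMSEQ tendsto_norm[OF rGamma_series_LIMSEQ]]]) auto
  \<comment> \<open>on the line \<open>Re = 1/2\<close>, reflection is complex conjugation\<close>
  have "1 - w = cnj w" by (simp add: w_def complex_eq_iff)
  hence "rGamma w * cnj (rGamma w) = sin (of_real pi * w) / of_real pi"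
    using rGamma_reflection_complex[of w] by (simp add: cnj_rGamma)
  hence "norm (rGamma w) ^ 2 = norm (sin (of_real pi * w)) / pi"
    by (metis complex_mod_cnj norm_divide norm_mult norm_of_real power2_eq_square abs_of_nonneg pi_ge_zero)
  also have "of_real pi * w = of_real pi / 2 - (- \<i> * of_real (pi * Im z))"
    by (simp add: w_def complex_eq_iff)
  also have "sin \<dots> = cos (- \<i> * of_real (pi * Im z))"
    by (metis cos_sin_eq)
  also have "norm \<dots> \<le> exp (pi * \<bar>Im z\<bar>)"
    using norm_cos_le[of "- \<i> * of_real (pi * Im z)"] by (simp add: norm_mult abs_mult)
  finally have "norm (rGamma w) ^ 2 \<le> (exp (pi / 2 * \<bar>Im z\<bar>) / sqrt pi) ^ 2"
    by (simp add: power_divide divide_right_mono flip: exp_double)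
  hence "norm (rGamma w) \<le> exp (pi / 2 * \<bar>Im z\<bar>) / sqrt pi"
    by (rule power2_le_imp_le) auto
  moreover have "rGamma (Re z) \<ge> 0"
    using assms by (simp add: rGamma_inverse_Gamma less_imp_le)
  ultimately have "rGamma (Re z) * norm (rGamma w) \<le> rGamma (Re z) * (exp (pi / 2 * \<bar>Im z\<bar>) / sqrt pi)"
    by (intro mult_left_mono)
  with le have "norm (rGamma z) * rGamma (1/2) \<le> rGamma (Re z) * (exp (pi / 2 * \<bar>Im z\<bar>) / sqrt pi)"
    by linarith
  thus ?thesis by (simp add: rGamma_inverse_Gamma Gamma_one_half_real field_simps)
qed

text \<open>
  Euler's integral restricted to \<open>t \<ge> A\<close> gives \<open>\<Gamma> x \<ge> A powr (x - 1) * exp (- A)\<close>. As \<open>A\<close> is arbitrary,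
  \<open>\<Gamma>\<close> outgrows every exponential function.
\<close>
lemma rGamma_real_le:
  fixes x A :: real
  assumes "x \<ge> 1" "A > 0"
  shows "rGamma x \<le> exp A * A powr (1 - x)"
proof -
  have "((\<lambda>t. A powr (x - 1) * exp (-1 * t)) has_integral A powr (x - 1) * (exp (-1 * A) / 1)) {A..}"
    by (intro has_integral_mult_right has_integral_exp_minus_to_infinity) auto
  hence "((\<lambda>t. if t \<in> {A..} then A powr (x - 1) * exp (-1 * t) else 0)
      has_integral A powr (x - 1) * (exp (-1 * A) / 1)) {0..}"
    using assms by (subst has_integral_restrict) auto
  moreover have "((\<lambda>t. t powr (x - 1) / exp t) has_integral Gamma x) {0..}"
    using Gamma_integral_real[of x] assms by simp
  moreover have "(if t \<in> {A..} then A powr (x - 1) * exp (-1 * t) else 0) \<le> t powr (x - 1) / exp t" for t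
    using assms by (auto simp: exp_minus field_simps intro!: powr_mono2)
  ultimately have "A powr (x - 1) * (exp (-1 * A) / 1) \<le> Gamma x"
    by (rule has_integral_le)
  moreover have "Gamma x > 0" using assms by simp
  ultimately show ?thesis using assms
    by (simp add: rGamma_inverse_Gamma exp_minus powr_diff field_simps)
qed

text \<open>
  The power series of two-parametric Mittag-Leffler type \<open>(\<Sum>n. x ^ n / \<Gamma> (q + \<upsilon> * n))\<close> is entire
  when \<open>Re \<upsilon> > 0\<close>, for complex \<open>\<upsilon>\<close> as well: the loss \<open>exp (pi / 2 * \<bar>Im \<upsilon>\<bar> * n)\<close> from leaving the real
  axis is geometric and is absorbed by a large choice of the base \<open>A\<close> in \<open>rGamma_real_le\<close>.
\<close>
lemma summable_rGamma_arith_progression: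
  fixes q \<upsilon> :: complex and K :: real
  assumes "Re \<upsilon> > 0" "K \<ge> 0"
  shows "summable (\<lambda>n. K ^ n * norm (rGamma (q + \<upsilon> * of_nat n)))"
proof -
  define L where "L = K * exp (pi / 2 * \<bar>Im \<upsilon>\<bar>)"
  \<comment> \<open>With this base the \<open>n\<close>-th term, for large \<open>n\<close>, is at most \<open>C * (L / (2 * L + 1)) ^ n\<close>, a ratio below \<open>1/2\<close>.\<close>
  define A where "A = (2 * L + 1) powr (1 / Re \<upsilon>)"
  define C where "C = exp (pi / 2 * \<bar>Im q\<bar>) * exp A * A powr (1 - Re q)"
  have L: "L \<ge> 0" unfolding L_def using assms by simp
  have A: "A > 0" "A powr Re \<upsilon> = 2 * L + 1"
    unfolding A_def using L assms by (auto simp: powr_powr)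
  have "summable (\<lambda>n. C * (1/2) ^ n :: real)"
    by (intro summable_mult summable_geometric) auto
  moreover have "eventually (\<lambda>n. norm (K ^ n * norm (rGamma (q + \<upsilon> * of_nat n))) \<le> C * (1/2) ^ n) sequentially"
    using eventually_ge_at_top[of "nat \<lceil>(1 + \<bar>Re q\<bar>) / Re \<upsilon>\<rceil>"]
  proof eventually_elim
    case (elim n)
    hence "(1 + \<bar>Re q\<bar>) / Re \<upsilon> \<le> real n" by linarith
    hence "1 + \<bar>Re q\<bar> \<le> Re \<upsilon> * real n" using assms by (simp add: field_simps)
    hence Re: "Re q + Re \<upsilon> * real n \<ge> 1" by linarith
    have "norm (rGamma (q + \<upsilon> * of_nat n))
        \<le> exp (pi / 2 * \<bar>Im q + Im \<upsilon> * real n\<bar>) * rGamma (Re q + Re \<upsilon> * real n)"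
      using norm_rGamma_le[of "q + \<upsilon> * of_nat n"] Re by simp
    also have "\<dots> \<le> exp (pi / 2 * \<bar>Im q\<bar> + real n * (pi / 2 * \<bar>Im \<upsilon>\<bar>))
                     * (exp A * A powr (1 - (Re q + Re \<upsilon> * real n)))"
    proof (intro mult_mono rGamma_real_le)
      have "\<bar>Im q + Im \<upsilon> * real n\<bar> \<le> \<bar>Im q\<bar> + real n * \<bar>Im \<upsilon>\<bar>"
        using abs_triangle_ineq[of "Im q" "Im \<upsilon> * real n"] by (simp add: abs_mult mult.commute)
      from mult_left_mono[OF this, of "pi / 2"]
      show "exp (pi / 2 * \<bar>Im q + Im \<upsilon> * real n\<bar>) \<le> exp (pi / 2 * \<bar>Im q\<bar> + real n * (pi / 2 * \<bar>Im \<upsilon>\<bar>))"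
        by (simp add: algebra_simps)
    qed (use Re A in \<open>auto simp: rGamma_inverse_Gamma less_imp_le\<close>)
    also have "A powr (1 - (Re q + Re \<upsilon> * real n)) = A powr (1 - Re q) / (A powr Re \<upsilon>) ^ n"
      using A(1) by (simp add: powr_diff powr_add powr_powr flip: powr_realpow)
    also have "exp (pi / 2 * \<bar>Im q\<bar> + real n * (pi / 2 * \<bar>Im \<upsilon>\<bar>))
        = exp (pi / 2 * \<bar>Im q\<bar>) * exp (pi / 2 * \<bar>Im \<upsilon>\<bar>) ^ n"
      by (simp only: exp_add exp_of_nat_mult)
    finally have "norm (rGamma (q + \<upsilon> * of_nat n)) \<le> C * (exp (pi / 2 * \<bar>Im \<upsilon>\<bar>) / (2 * L + 1)) ^ n"
      unfolding A(2) by (simp add: C_def power_divide mult_ac)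
    hence "K ^ n * norm (rGamma (q + \<upsilon> * of_nat n)) \<le> K ^ n * (C * (exp (pi / 2 * \<bar>Im \<upsilon>\<bar>) / (2 * L + 1)) ^ n)"
      using assms by (intro mult_left_mono) auto
    also have "\<dots> = C * (L / (2 * L + 1)) ^ n"
      by (simp add: L_def power_mult_distrib power_divide)
    also have "\<dots> \<le> C * (1/2) ^ n"
      using L by (intro mult_left_mono power_mono) (auto simp: C_def field_simps)
    finally show ?case using assms by simp
  qed
  ultimately show ?thesis by (rule summable_comparison_test_ev[rotated])
qed

section \<open>Integrals of power kernels against continuous factors\<close>

lemma continuous_on_suminf:
  fixes f :: "nat \<Rightarrow> 'a :: topological_space \<Rightarrow> 'b :: banach"
  assumes "\<And>n. continuous_on S (f n)" "\<And>n x. x \<in> S \<Longrightarrow> norm (f n x) \<le> M n" "summable M"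
  shows "continuous_on S (\<lambda>x. \<Sum>n. f n x)"
proof (rule uniform_limit_theorem)
  show "uniform_limit S (\<lambda>n x. \<Sum>i<n. f i x) (\<lambda>x. \<Sum>n. f n x) sequentially"
    using assms(2,3) by (rule Weierstrass_m_test)
  show "\<forall>\<^sub>F n in sequentially. continuous_on S (\<lambda>x. \<Sum>i<n. f i x)"
    using assms(1) by (intro always_eventually allI continuous_on_sum)
qed simp

text \<open>
  A Weierstrass test for iterated series. The product form of the majorant is what lets the outer
  series be handled by the same test as the inner one.
\<close>
lemma continuous_on_double_suminf:
  fixes f :: "nat \<Rightarrow> nat \<Rightarrow> 'a :: topological_space \<Rightarrow> 'b :: banach"
  assumes "\<And>l n. continuous_on S (f l n)"
    and bound: "\<And>l n x. x \<in> S \<Longrightarrow> norm (f l n x) \<le> P l * Q n"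
    and "summable P" "summable Q"
  shows "continuous_on S (\<lambda>x. \<Sum>l. \<Sum>n. f l n x)"
proof (rule continuous_on_suminf)
  show "continuous_on S (\<lambda>x. \<Sum>n. f l n x)" for l
    using assms by (intro continuous_on_suminf[where M = "\<lambda>n. P l * Q n"] summable_mult) auto
  show "norm (\<Sum>n. f l n x) \<le> P l * suminf Q" if "x \<in> S" for l x
  proof -
    have "summable (\<lambda>n. P l * Q n)" using assms by (intro summable_mult)
    hence "norm (\<Sum>n. f l n x) \<le> (\<Sum>n. P l * Q n)"
      using bound[OF that] by (intro norm_suminf_le)
    thus ?thesis using \<open>summable Q\<close> by (simp add: suminf_mult)
  qed
  show "summable (\<lambda>l. P l * suminf Q)" using assms by (intro summable_mult2)
qed

lemma set_integrable_mult_continuous: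
  fixes k h :: "real \<Rightarrow> complex"
  assumes k: "set_integrable lborel S k" and S: "compact S" and h: "continuous_on S h"
  shows "set_integrable lborel S (\<lambda>s. k s * h s)"
proof -
  have "bounded (h ` S)"
    using S h by (intro compact_imp_bounded compact_continuous_image)
  then obtain B where B: "\<And>s. s \<in> S \<Longrightarrow> norm (h s) \<le> B"
    unfolding bounded_iff by blast
  have meas: "set_borel_measurable lborel S (\<lambda>s. k s * h s)"
  proof -
    have [measurable]: "(\<lambda>s. indicator S s *\<^sub>R k s) \<in> borel_measurable lborel"
      using k unfolding set_integrable_def by (rule borel_measurable_integrable)
    have [measurable]: "(\<lambda>s. indicator S s *\<^sub>R h s) \<in> borel_measurable lborel"
      using borel_measurable_continuous_on_indicator[OF _ h] S
      by (simp add: borel_compact measurable_lborel1)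
    have "(\<lambda>s. (indicator S s *\<^sub>R k s) * (indicator S s *\<^sub>R h s)) \<in> borel_measurable lborel"
      by measurable
    also have "(\<lambda>s. (indicator S s *\<^sub>R k s) * (indicator S s *\<^sub>R h s)) = (\<lambda>s. indicator S s *\<^sub>R (k s * h s))"
      by (auto simp: indicator_def)
    finally show ?thesis unfolding set_borel_measurable_def .
  qed
  have le: "norm (k s * h s) \<le> norm (of_real B * k s)" if "s \<in> S" for s
    using mult_right_mono[OF order_trans[OF B[OF that] abs_ge_self], of "norm (k s)"]
    by (simp add: norm_mult mult.commute)
  show ?thesis
  proof (rule set_integrable_bound)
    show "set_integrable lborel S (\<lambda>s. of_real B * k s)" using k by simp
  qed (use meas le in auto)
qed

text \<open>
  By compactness \<open>h\<close> is bounded, so a multiple of \<open>norm (k s)\<close> dominates; the kernel itself may be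
  unbounded.
\<close>
lemma continuous_on_parametric_integral:
  fixes k :: "real \<Rightarrow> complex" and h :: "'a :: metric_space \<Rightarrow> real \<Rightarrow> complex"
  assumes k: "set_integrable lborel S k" and S: "compact S" and X: "compact X"
    and h: "continuous_on (X \<times> S) (\<lambda>(x, s). h x s)"
  shows "continuous_on X (\<lambda>x. LBINT s:S. k s * h x s)"
  unfolding continuous_on_sequentially
proof (intro allI ballI impI)
  fix x a assume "a \<in> X" "(\<forall>n. x n \<in> X) \<and> x \<longlonglongrightarrow> a"
  hence x: "a \<in> X" "\<And>n. x n \<in> X" "x \<longlonglongrightarrow> a" by auto
  have "bounded ((\<lambda>(x, s). h x s) ` (X \<times> S))"
    using S X h by (intro compact_imp_bounded compact_continuous_image compact_Times)
  then obtain B where B: "\<And>x s. x \<in> X \<Longrightarrow> s \<in> S \<Longrightarrow> norm (h x s) \<le> B"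
    unfolding bounded_iff by fastforce
  have int: "set_integrable lborel S (\<lambda>s. k s * h y s)" if "y \<in> X" for y
  proof -
    have "continuous_on S (\<lambda>s. (\<lambda>(x, s). h x s) (y, s))"
      by (rule continuous_on_compose2[OF h]) (use that in \<open>auto intro!: continuous_intros\<close>)
    thus ?thesis using k S by (intro set_integrable_mult_continuous) auto
  qed
  have lim: "(\<lambda>n. h (x n) s) \<longlonglongrightarrow> h a s" if "s \<in> S" for s
  proof -
    have "(\<lambda>n. (x n, s)) \<longlonglongrightarrow> (a, s)" using x by (intro tendsto_intros)
    hence "(\<lambda>n. (\<lambda>(x, s). h x s) (x n, s)) \<longlonglongrightarrow> (\<lambda>(x, s). h x s) (a, s)"
      using x that by (intro continuous_on_tendsto_compose[OF h]) auto
    thus ?thesis by simp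
  qed
  have "(\<lambda>n. LBINT s:S. k s * h (x n) s) \<longlonglongrightarrow> (LBINT s:S. k s * h a s)"
    unfolding set_lebesgue_integral_def
  proof (rule integral_dominated_convergence[where w = "\<lambda>s. norm (indicator S s *\<^sub>R k s) * B"])
    show "(\<lambda>s. indicator S s *\<^sub>R (k s * h a s)) \<in> borel_measurable lborel"
      and "\<And>n. (\<lambda>s. indicator S s *\<^sub>R (k s * h (x n) s)) \<in> borel_measurable lborel"
      using int x unfolding set_integrable_def by (auto intro: borel_measurable_integrable)
    show "integrable lborel (\<lambda>s. norm (indicator S s *\<^sub>R k s) * B)"
      using k unfolding set_integrable_def by (intro integrable_mult_left integrable_norm)
    show "AE s in lborel. (\<lambda>n. indicator S s *\<^sub>R (k s * h (x n) s)) \<longlonglongrightarrow> indicator S s *\<^sub>R (k s * h a s)"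
      using lim by (intro AE_I2) (auto simp: indicator_def intro!: tendsto_intros)
    show "AE s in lborel. norm (indicator S s *\<^sub>R (k s * h (x n) s)) \<le> norm (indicator S s *\<^sub>R k s) * B" for n
      by (intro AE_I2) (auto simp: indicator_def norm_mult mult_left_mono[OF B[OF x(2)]])
  qed
  thus "((\<lambda>x. LBINT s:S. k s * h x s) \<circ> x) \<longlonglongrightarrow> (LBINT s:S. k s * h a s)"
    by (simp add: o_def)
qed

lemma nn_integral_powr_kernel:
  fixes a z c :: real
  assumes "c > 0" "a \<le> z"
  shows "(\<integral>\<^sup>+\<xi>. ennreal ((z - \<xi>) powr (c - 1)) * indicator {a..z} \<xi> \<partial>lborel) = ennreal ((z - a) powr c / c)"
proof -
  have "(\<integral>\<^sup>+\<xi>. ennreal ((z - \<xi>) powr (c - 1)) * indicator {a..z} \<xi> \<partial>lborel)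
      = (\<integral>\<^sup>+u. ennreal ((z - (z + - 1 * u)) powr (c - 1)) * indicator {a..z} (z + - 1 * u) \<partial>lborel)"
    by (subst nn_integral_real_affine[where c = "-1" and t = z]) auto
  also have "\<dots> = (\<integral>\<^sup>+u. ennreal (u powr (c - 1)) * indicator {0..z - a} u \<partial>lborel)"
    by (intro nn_integral_cong) (auto simp: indicator_def)
  also have "\<dots> = ennreal ((z - a) powr c / c)"
    using has_integral_powr_from_0[of "c - 1" "z - a"] assms
    by (intro nn_integral_has_integral_lebesgue') auto
  finally show ?thesis .
qed

lemma set_integrable_powr_kernel:
  fixes p :: complex and a z :: real
  assumes "Re p > 0" "a \<le> z"
  shows "set_integrable lborel {a..z} (\<lambda>\<xi>. complex_of_real (z - \<xi>) powr (p - 1))"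
  unfolding set_integrable_def
proof (rule integrableI_bounded)
  have "(\<lambda>\<xi>. indicator {a..<z} \<xi> *\<^sub>R complex_of_real (z - \<xi>) powr (p - 1)) \<in> borel_measurable borel"
    by (intro borel_measurable_continuous_on_indicator continuous_on_powr_complex continuous_intros) auto
  also have "(\<lambda>\<xi>. indicator {a..<z} \<xi> *\<^sub>R complex_of_real (z - \<xi>) powr (p - 1))
      = (\<lambda>\<xi>. indicator {a..z} \<xi> *\<^sub>R complex_of_real (z - \<xi>) powr (p - 1))"
    by (auto simp: fun_eq_iff indicator_def less_le)
  finally show "(\<lambda>\<xi>. indicator {a..z} \<xi> *\<^sub>R complex_of_real (z - \<xi>) powr (p - 1)) \<in> borel_measurable lborel"
    by simp
  have "(\<integral>\<^sup>+\<xi>. ennreal (norm (indicator {a..z} \<xi> *\<^sub>R complex_of_real (z - \<xi>) powr (p - 1))) \<partial>lborel)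
      = (\<integral>\<^sup>+\<xi>. ennreal ((z - \<xi>) powr (Re p - 1)) * indicator {a..z} \<xi> \<partial>lborel)"
    by (intro nn_integral_cong) (auto simp: indicator_def norm_powr_real_powr)
  also have "\<dots> < \<infinity>" using nn_integral_powr_kernel[of "Re p" a z] assms by simp
  finally show "(\<integral>\<^sup>+\<xi>. ennreal (norm (indicator {a..z} \<xi> *\<^sub>R complex_of_real (z - \<xi>) powr (p - 1))) \<partial>lborel) < \<infinity>" .
qed

text \<open>
  Substituting \<open>\<xi> = a + (z - a) * s\<close> makes the domain of integration independent of \<open>z\<close>. At \<open>z = a\<close>
  both sides vanish, by the convention \<open>0 powr p = 0\<close> on the right.
\<close>
lemma powr_kernel_integral_rescale:
  fixes p :: complex and a z :: real and g :: "real \<Rightarrow> complex"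
  assumes "a \<le> z"
  shows "(LBINT \<xi>:{a..z}. complex_of_real (z - \<xi>) powr (p - 1) * g \<xi>)
    = complex_of_real (z - a) powr p
      * (LBINT s:{0..1}. complex_of_real (1 - s) powr (p - 1) * g (a + (z - a) * s))"
proof (cases "a = z")
  case True
  have "(LBINT \<xi>:{a..z}. complex_of_real (z - \<xi>) powr (p - 1) * g \<xi>) = (LBINT \<xi>:{a..z}. 0)"
    using True by (intro set_lebesgue_integral_cong) auto
  thus ?thesis using True by simp
next
  case False
  hence az: "a < z" using assms by simp
  have "a + (z - a) * 0 \<le> a + (z - a) * s \<longleftrightarrow> 0 \<le> s"
       "a + (z - a) * s \<le> a + (z - a) * 1 \<longleftrightarrow> s \<le> 1" for s
    using az by (simp_all only: add_le_cancel_left mult_le_cancel_left_pos diff_gt_0_iff_gt)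
  hence mem: "a + (z - a) * s \<in> {a..z} \<longleftrightarrow> s \<in> {0..1}" for s
    by (simp only: atLeastAtMost_iff mult_zero_right mult_1_right add_0_right 
        add.commute[of a "z - a"] diff_add_cancel add.commute[of "z - a"])
  let ?f = "\<lambda>\<xi>. indicator {a..z} \<xi> *\<^sub>R (complex_of_real (z - \<xi>) powr (p - 1) * g \<xi>)"
  have eq: "?f (a + (z - a) * s) = complex_of_real (z - a) powr (p - 1) *
      (indicator {0..1} s *\<^sub>R (complex_of_real (1 - s) powr (p - 1) * g (a + (z - a) * s)))" for s
  proof (cases "s \<in> {0..1}")
    case True
    have "z - (a + (z - a) * s) = (z - a) * (1 - s)" by (simp add: algebra_simps)
    hence "complex_of_real (z - (a + (z - a) * s)) powr (p - 1)
        = complex_of_real (z - a) powr (p - 1) * complex_of_real (1 - s) powr (p - 1)"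
      using True az powr_times_real[of "complex_of_real (z - a)" "complex_of_real (1 - s)" "p - 1"]
      by simp
    moreover have "a + (z - a) * s \<in> {a..z}" using mem True by simp
    ultimately show ?thesis using True by simp
  next
    case False
    hence "a + (z - a) * s \<notin> {a..z}" using mem by simp
    with False show ?thesis by simp
  qed
  have "(LBINT \<xi>:{a..z}. complex_of_real (z - \<xi>) powr (p - 1) * g \<xi>)
    = \<bar>z - a\<bar> *\<^sub>R (LBINT s. ?f (a + (z - a) * s))"
    unfolding set_lebesgue_integral_def
    by (rule lborel_integral_real_affine) (use az in simp)
  also have "(LBINT s. ?f (a + (z - a) * s)) = complex_of_real (z - a) powr (p - 1)
      * (LBINT s:{0..1}. complex_of_real (1 - s) powr (p - 1) * g (a + (z - a) * s))"
    unfolding set_lebesgue_integral_def eq by (rule integral_mult_right_zero)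
  also have "\<bar>z - a\<bar> *\<^sub>R \<dots> = (complex_of_real (z - a) * complex_of_real (z - a) powr (p - 1))
      * (LBINT s:{0..1}. complex_of_real (1 - s) powr (p - 1) * g (a + (z - a) * s))"
    using az by (simp add: scaleR_conv_of_real mult.assoc)
  also have "complex_of_real (z - a) * complex_of_real (z - a) powr (p - 1) = complex_of_real (z - a) powr p"
    using az by (simp add: powr_diff)
  finally show ?thesis .
qed

section \<open>Series and integrals in the extended nonnegative reals\<close>

text \<open>
  If the series of norms diverges, the right-hand side is \<open>top\<close>.
\<close>
lemma ennreal_norm_suminf_le:
  fixes f :: "nat \<Rightarrow> 'a :: banach"
  shows "ennreal (norm (suminf f)) \<le> (\<Sum>n. ennreal (norm (f n)))"
proof (cases "summable (\<lambda>n. norm (f n))")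
  case True
  thus ?thesis by (simp add: suminf_ennreal2 summable_norm ennreal_leI)
next
  case False
  hence "(\<Sum>n. ennreal (norm (f n))) = top"
    using summable_suminf_not_top[of "\<lambda>n. norm (f n)"] by (metis norm_ge_zero)
  thus ?thesis by simp
qed

text \<open>
  Fubini for counting measure.
\<close>
lemma ennreal_suminf_swap:
  fixes f :: "nat \<Rightarrow> nat \<Rightarrow> ennreal"
  shows "(\<Sum>m. \<Sum>n. f m n) = (\<Sum>n. \<Sum>m. f m n)"
proof -
  have "(\<Sum>m. \<Sum>n. f m n) = (\<Sum>m. \<integral>\<^sup>+n. f m n \<partial>count_space UNIV)"
    by (simp only: nn_integral_count_space_nat)
  also have "\<dots> = (\<integral>\<^sup>+n. (\<Sum>m. f m n) \<partial>count_space UNIV)"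
    by (rule nn_integral_suminf[symmetric]) simp
  also have "\<dots> = (\<Sum>n. \<Sum>m. f m n)"
    by (rule nn_integral_count_space_nat)
  finally show ?thesis .
qed

lemma ennreal_norm_set_integral_le:
  fixes f :: "'a \<Rightarrow> 'b :: {banach, second_countable_topology}"
  shows "ennreal (norm (LINT x:S|M. f x)) \<le> (\<integral>\<^sup>+x. ennreal (norm (f x)) * indicator S x \<partial>M)"
proof (cases "integrable M (\<lambda>x. indicator S x *\<^sub>R f x)")
  case True
  have "ennreal (norm (LINT x:S|M. f x)) \<le> (\<integral>\<^sup>+x. ennreal (norm (indicator S x *\<^sub>R f x)) \<partial>M)"
    unfolding set_lebesgue_integral_def by (rule integral_norm_bound_ennreal[OF True])
  also have "\<dots> = (\<integral>\<^sup>+x. ennreal (norm (f x)) * indicator S x \<partial>M)"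
    by (intro nn_integral_cong) (auto simp: indicator_def)
  finally show ?thesis .
qed (simp add: set_lebesgue_integral_def not_integrable_integral_eq)

section \<open>Double integrals with power kernels\<close>

text \<open>
  Valid at \<open>x = 0\<close> for every \<open>a\<close> and \<open>n\<close>: there both sides are \<open>0\<close>, because \<open>0 powr a = 0\<close> even when
  \<open>a = 0\<close>.
\<close>
lemma powr_add_of_nat:
  fixes x a :: real
  assumes "x \<ge> 0"
  shows "x powr a * x ^ n = x powr (a + real n)"
  using assms by (cases "x = 0") (auto simp: powr_add powr_realpow)

lemma powr_add_mult_of_nat:
  fixes x a b :: real
  assumes "x \<ge> 0"
  shows "x powr a * (x powr b) ^ n = x powr (a + b * real n)"
  using assms by (cases "x = 0") (auto simp: powr_add powr_powr simp flip: powr_realpow)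

text \<open>
  The operator is studied for an arbitrary continuous \<open>\<Psi>\<close> in place of the Mittag-Leffler function:
  integrability and continuity of the image come from the two kernels and the continuity of \<open>\<Psi>\<close>.
\<close>
context
  fixes \<Psi> :: "real \<Rightarrow> real \<Rightarrow> complex" and d :: "real \<times> real \<Rightarrow> complex" and p q :: complex
    and a1 a2 b1 b2 :: real
  assumes p: "Re p > 0" and q: "Re q > 0"
    and \<Psi>: "continuous_on ({0..a2 - a1} \<times> {0..b2 - b1}) (\<lambda>(u, v). \<Psi> u v)"
    and d: "continuous_on ({a1..a2} \<times> {b1..b2}) d"
begin

text \<open>
  The outer kernel does not involve \<open>\<xi>\<close>. The inner integral is therefore the outer kernel times a
  parametric integral, which is continuous in \<open>y\<close>.
\<close>
lemma double_powr_kernel_integrable: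
  assumes z: "z \<in> {a1..a2}" and t: "t \<in> {b1..b2}"
  shows "\<forall>y\<in>{b1..t}. set_integrable lborel {a1..z} (\<lambda>\<xi>.
            complex_of_real (t - y) powr (q - 1) * complex_of_real (z - \<xi>) powr (p - 1)
              * \<Psi> (z - \<xi>) (t - y) * d (\<xi>, y))"
    and "set_integrable lborel {b1..t} (\<lambda>y. LBINT \<xi>:{a1..z}.
            complex_of_real (t - y) powr (q - 1) * complex_of_real (z - \<xi>) powr (p - 1)
              * \<Psi> (z - \<xi>) (t - y) * d (\<xi>, y))"
proof -
  define h where "h = (\<lambda>y \<xi>. \<Psi> (z - \<xi>) (t - y) * d (\<xi>, y))"
  have h: "continuous_on ({b1..t} \<times> {a1..z}) (\<lambda>(y, \<xi>). h y \<xi>)"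
  proof -
    have "continuous_on ({b1..t} \<times> {a1..z}) (\<lambda>x. (\<lambda>(u, v). \<Psi> u v) (z - snd x, t - fst x))"
      by (rule continuous_on_compose2[OF \<Psi>]) (use z t in \<open>auto intro!: continuous_intros\<close>)
    moreover have "continuous_on ({b1..t} \<times> {a1..z}) (\<lambda>x. d (snd x, fst x))"
      by (rule continuous_on_compose2[OF d]) (use z t in \<open>auto intro!: continuous_intros\<close>)
    ultimately show ?thesis
      unfolding h_def case_prod_beta by (intro continuous_on_mult) auto
  qed
  have eq: "complex_of_real (t - y) powr (q - 1) * complex_of_real (z - \<xi>) powr (p - 1)
              * \<Psi> (z - \<xi>) (t - y) * d (\<xi>, y)
          = complex_of_real (t - y) powr (q - 1) * (complex_of_real (z - \<xi>) powr (p - 1) * h y \<xi>)" for y \<xi>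
    by (simp add: h_def mult_ac)
  have k: "set_integrable lborel {a1..z} (\<lambda>\<xi>. complex_of_real (z - \<xi>) powr (p - 1))"
    using p z by (intro set_integrable_powr_kernel) auto
  show "\<forall>y\<in>{b1..t}. set_integrable lborel {a1..z} (\<lambda>\<xi>.
            complex_of_real (t - y) powr (q - 1) * complex_of_real (z - \<xi>) powr (p - 1)
              * \<Psi> (z - \<xi>) (t - y) * d (\<xi>, y))"
  proof
    fix y assume y: "y \<in> {b1..t}"
    have "continuous_on {a1..z} (\<lambda>\<xi>. (\<lambda>(y, \<xi>). h y \<xi>) (y, \<xi>))"
      by (rule continuous_on_compose2[OF h]) (use y in \<open>auto intro!: continuous_intros\<close>)
    hence "set_integrable lborel {a1..z} (\<lambda>\<xi>. complex_of_real (z - \<xi>) powr (p - 1) * h y \<xi>)"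
      by (intro set_integrable_mult_continuous[OF k]) auto
    thus "set_integrable lborel {a1..z} (\<lambda>\<xi>.
            complex_of_real (t - y) powr (q - 1) * complex_of_real (z - \<xi>) powr (p - 1)
              * \<Psi> (z - \<xi>) (t - y) * d (\<xi>, y))"
      unfolding eq by (rule set_integrable_mult_right)
  qed
  have "continuous_on {b1..t} (\<lambda>y. LBINT \<xi>:{a1..z}. complex_of_real (z - \<xi>) powr (p - 1) * h y \<xi>)"
    by (rule continuous_on_parametric_integral[OF k _ _ h]) auto
  thus "set_integrable lborel {b1..t} (\<lambda>y. LBINT \<xi>:{a1..z}.
            complex_of_real (t - y) powr (q - 1) * complex_of_real (z - \<xi>) powr (p - 1)
              * \<Psi> (z - \<xi>) (t - y) * d (\<xi>, y))"
    unfolding eq set_integral_mult_right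
    using q t by (intro set_integrable_mult_continuous set_integrable_powr_kernel) auto
qed

text \<open>
  After rescaling, the double integral is \<open>(z - a1) powr p * (t - b1) powr q\<close> times an iterated
  parametric integral over the unit square, with integrable kernels \<open>(1 - s) powr (p - 1)\<close> and
  \<open>(1 - r) powr (q - 1)\<close>. The prefactor is continuous up to the edges \<open>z = a1\<close> and \<open>t = b1\<close> as
  \<open>Re p\<close> and \<open>Re q\<close> are positive.
\<close>
lemma double_powr_kernel_continuous:
  "continuous_on ({a1..a2} \<times> {b1..b2}) (\<lambda>(z, t). LBINT y:{b1..t}. LBINT \<xi>:{a1..z}.
      complex_of_real (t - y) powr (q - 1) * complex_of_real (z - \<xi>) powr (p - 1)
        * \<Psi> (z - \<xi>) (t - y) * d (\<xi>, y))"
proof -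
  let ?R = "{a1..a2} \<times> {b1..b2}"
  define h where "h = (\<lambda>((z, t), r) s. \<Psi> ((z - a1) * (1 - s)) ((t - b1) * (1 - r))
     * d (a1 + (z - a1) * s, b1 + (t - b1) * r))"
  define H where "H = (\<lambda>x r. LBINT s:{0..1}. complex_of_real (1 - s) powr (p - 1) * h (x, r) s)"
  have kernel: "set_integrable lborel {0..1} (\<lambda>s. complex_of_real (1 - s) powr (c - 1))"
    if "Re c > 0" for c using set_integrable_powr_kernel[of c 0 1] that by simp
  have le: "x * s \<le> c" if "0 \<le> x" "x \<le> c" "0 \<le> s" "s \<le> 1" for x s c :: real
    using mult_mono[of x c s 1] that by simp
  have "continuous_on ((?R \<times> {0..1}) \<times> {0..1}) (\<lambda>(x, s). h x s)"
  proof -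
    have "continuous_on ((?R \<times> {0..1}) \<times> {0..1}) (\<lambda>x. (\<lambda>(u, v). \<Psi> u v)
        ((fst (fst (fst x)) - a1) * (1 - snd x), (snd (fst (fst x)) - b1) * (1 - snd (fst x))))"
      by (rule continuous_on_compose2[OF \<Psi>]) (auto intro!: continuous_intros le)
    moreover have "continuous_on ((?R \<times> {0..1}) \<times> {0..1}) (\<lambda>x. d
        (a1 + (fst (fst (fst x)) - a1) * snd x, b1 + (snd (fst (fst x)) - b1) * snd (fst x)))"
    proof (rule continuous_on_compose2[OF d], goal_cases)
      case 2
      have "a1 + (z - a1) * s \<le> a2" if "a1 \<le> z" "z \<le> a2" "0 \<le> s" "s \<le> 1" for z s
        using le[of "z - a1" "a2 - a1" s] that by simp
      moreover have "b1 + (z - b1) * s \<le> b2" if "b1 \<le> z" "z \<le> b2" "0 \<le> s" "s \<le> 1" for z s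
        using le[of "z - b1" "b2 - b1" s] that by simp
      ultimately show ?case by auto
    qed (intro continuous_intros)
    ultimately show ?thesis
      unfolding h_def case_prod_beta by (intro continuous_on_mult) auto
  qed
  hence "continuous_on (?R \<times> {0..1}) (\<lambda>x. LBINT s:{0..1}. complex_of_real (1 - s) powr (p - 1) * h x s)"
    using p by (intro continuous_on_parametric_integral kernel compact_Times) auto
  hence "continuous_on (?R \<times> {0..1}) (\<lambda>(x, r). H x r)"
    by (simp add: H_def case_prod_beta)
  hence H: "continuous_on ?R (\<lambda>x. LBINT r:{0..1}. complex_of_real (1 - r) powr (q - 1) * H x r)"
    using q by (intro continuous_on_parametric_integral kernel compact_Times) auto
  have "continuous_on ?R (\<lambda>x. complex_of_real (fst x - a1) powr p * complex_of_real (snd x - b1) powr q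
      * (LBINT r:{0..1}. complex_of_real (1 - r) powr (q - 1) * H x r))"
    using p q
    by (intro continuous_on_mult H continuous_on_powr_complex continuous_intros) auto
  also have "?this \<longleftrightarrow> ?thesis"
  proof (rule continuous_on_cong[OF refl])
    fix x assume "x \<in> ?R"
    then obtain z t where x: "x = (z, t)" "a1 \<le> z" "b1 \<le> t" by auto
    have aff: "z - (a1 + (z - a1) * s) = (z - a1) * (1 - s)"
      "t - (b1 + (t - b1) * s) = (t - b1) * (1 - s)" for s
      by (simp_all add: algebra_simps)
    have inner: "(LBINT \<xi>:{a1..z}. complex_of_real (t - y) powr (q - 1) * complex_of_real (z - \<xi>) powr (p - 1)
        * \<Psi> (z - \<xi>) (t - y) * d (\<xi>, y))
      = complex_of_real (t - y) powr (q - 1) * (complex_of_real (z - a1) powr p *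
          (LBINT s:{0..1}. complex_of_real (1 - s) powr (p - 1)
            * (\<Psi> ((z - a1) * (1 - s)) (t - y) * d (a1 + (z - a1) * s, y))))" for y
      using powr_kernel_integral_rescale[of a1 z p "\<lambda>\<xi>. \<Psi> (z - \<xi>) (t - y) * d (\<xi>, y)"] x
      by (simp only: mult.assoc set_integral_mult_right aff)
    have "(LBINT y:{b1..t}. LBINT \<xi>:{a1..z}. complex_of_real (t - y) powr (q - 1)
        * complex_of_real (z - \<xi>) powr (p - 1) * \<Psi> (z - \<xi>) (t - y) * d (\<xi>, y))
      = complex_of_real (t - b1) powr q * (LBINT r:{0..1}. complex_of_real (1 - r) powr (q - 1)
          * (complex_of_real (z - a1) powr p * H (z, t) r))"
      unfolding inner using powr_kernel_integral_rescale[OF x(3), of q] 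
      by (simp only: aff H_def h_def prod.case)
    also have "\<dots> = complex_of_real (z - a1) powr p * complex_of_real (t - b1) powr q
        * (LBINT r:{0..1}. complex_of_real (1 - r) powr (q - 1) * H (z, t) r)"
      by (simp only: mult.left_commute[of _ "complex_of_real (z - a1) powr p"] set_integral_mult_right mult.assoc)
    finally show "complex_of_real (fst x - a1) powr p * complex_of_real (snd x - b1) powr q
          * (LBINT r:{0..1}. complex_of_real (1 - r) powr (q - 1) * H x r)
      = (case x of (z, t) \<Rightarrow> LBINT y:{b1..t}. LBINT \<xi>:{a1..z}.
          complex_of_real (t - y) powr (q - 1) * complex_of_real (z - \<xi>) powr (p - 1)
            * \<Psi> (z - \<xi>) (t - y) * d (\<xi>, y))"
      by (simp only: x prod.case fst_conv snd_conv)
  qed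
  finally show ?thesis .
qed

end

text \<open>
  Termwise integration of a majorant of \<open>\<Psi>\<close>. Everything is nonnegative, so sums and integrals
  may be exchanged whether or not they converge.
\<close>
lemma double_powr_kernel_bound:
  fixes \<Psi> :: "real \<Rightarrow> real \<Rightarrow> complex" and d :: "real \<times> real \<Rightarrow> complex" and p q :: complex
    and c :: "nat \<Rightarrow> nat \<Rightarrow> real"
  assumes p: "Re p > 0" and q: "Re q > 0" and b: "b \<ge> 0"
    and c: "\<And>l n. c l n \<ge> 0"
    and \<Psi>: "\<And>u v. u \<ge> 0 \<Longrightarrow> v \<ge> 0 \<Longrightarrow>
        ennreal (norm (\<Psi> u v)) \<le> (\<Sum>l. \<Sum>n. ennreal (c l n * u ^ l * (v powr b) ^ n))"
    and d: "\<And>\<xi> y. \<xi> \<in> {a..z} \<Longrightarrow> y \<in> {b'..t} \<Longrightarrow> norm (d (\<xi>, y)) \<le> D"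
    and "a \<le> z" "b' \<le> t"
  shows "ennreal (norm (LBINT y:{b'..t}. LBINT \<xi>:{a..z}.
            complex_of_real (t - y) powr (q - 1) * complex_of_real (z - \<xi>) powr (p - 1)
              * \<Psi> (z - \<xi>) (t - y) * d (\<xi>, y)))
    \<le> ennreal D * (\<Sum>l. \<Sum>n. ennreal (c l n * ((z - a) powr (Re p + real l) / (Re p + real l))
                                  * ((t - b') powr (Re q + b * real n) / (Re q + b * real n))))"
    (is "ennreal (norm (LBINT y:_. LBINT \<xi>:_. ?f \<xi> y)) \<le> _")
proof -
  \<comment> \<open>\<open>E l\<close> and \<open>F n\<close> are the kernels already multiplied with the \<open>l\<close>-th and \<open>n\<close>-th power of the majorant.\<close>
  define E where "E = (\<lambda>l \<xi>. ennreal ((z - \<xi>) powr (Re p + real l - 1)) * indicator {a..z} \<xi>)"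
  define F where "F = (\<lambda>n y. ennreal ((t - y) powr (Re q + b * real n - 1)) * indicator {b'..t} y)"
  have [measurable]: "E l \<in> borel_measurable borel" "F n \<in> borel_measurable borel" for l n
    unfolding E_def F_def by measurable
  have D: "D \<ge> 0"
    using order_trans[OF norm_ge_zero d[of a b']] assms by simp
  have intE: "(\<integral>\<^sup>+\<xi>. E l \<xi> \<partial>lborel) = ennreal ((z - a) powr (Re p + real l) / (Re p + real l))" for l
    unfolding E_def using assms by (intro nn_integral_powr_kernel) auto
  have intF: "(\<integral>\<^sup>+y. F n y \<partial>lborel) = ennreal ((t - b') powr (Re q + b * real n) / (Re q + b * real n))" for n
    unfolding F_def using assms by (intro nn_integral_powr_kernel add_pos_nonneg) auto
  have pointwise: "ennreal (norm (?f \<xi> y)) * indicator {a..z} \<xi> * indicator {b'..t} y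
      \<le> ennreal D * (\<Sum>l. \<Sum>n. ennreal (c l n) * F n y * E l \<xi>)" for \<xi> y
  proof (cases "\<xi> \<in> {a..z} \<and> y \<in> {b'..t}")
    case True
    define u v where "u = z - \<xi>" "v = t - y"
    have uv: "u \<ge> 0" "v \<ge> 0" using True by (auto simp: u_v_def)
    have "ennreal (norm (?f \<xi> y)) = ennreal (v powr (Re q - 1) * u powr (Re p - 1)) * ennreal (norm (\<Psi> u v)) * ennreal (norm (d (\<xi>, y)))"
      using uv unfolding u_v_def[symmetric]
      by (simp add: norm_mult norm_powr_real_powr flip: ennreal_mult)
    also have "\<dots> \<le> ennreal (v powr (Re q - 1) * u powr (Re p - 1)) *
        (\<Sum>l. \<Sum>n. ennreal (c l n * u ^ l * (v powr b) ^ n)) * ennreal D"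
      using True by (intro mult_mono \<Psi> uv ennreal_leI d) auto
    also have "\<dots> = ennreal D * (\<Sum>l. \<Sum>n. ennreal (v powr (Re q - 1) * u powr (Re p - 1)) * ennreal (c l n * u ^ l * (v powr b) ^ n))"
      by (simp add: mult_ac)
    also have "(\<lambda>l n. ennreal (v powr (Re q - 1) * u powr (Re p - 1)) * ennreal (c l n * u ^ l * (v powr b) ^ n))
        = (\<lambda>l n. ennreal (c l n) * F n y * E l \<xi>)"
    proof (intro ext)
      fix l n
      have "v powr (Re q - 1) * (v powr b) ^ n = v powr (Re q + b * real n - 1)"
        "u powr (Re p - 1) * u ^ l = u powr (Re p + real l - 1)"
        using powr_add_mult_of_nat[OF uv(2), of "Re q - 1" b n] powr_add_of_nat[OF uv(1), of "Re p - 1" l]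
        by (simp_all add: algebra_simps)
      moreover have "(v powr (Re q - 1) * u powr (Re p - 1)) * (c l n * u ^ l * (v powr b) ^ n)
          = c l n * (v powr (Re q - 1) * (v powr b) ^ n) * (u powr (Re p - 1) * u ^ l)"
        by (simp only: mult_ac)
      ultimately have "(v powr (Re q - 1) * u powr (Re p - 1)) * (c l n * u ^ l * (v powr b) ^ n)
          = c l n * v powr (Re q + b * real n - 1) * u powr (Re p + real l - 1)"
        by simp
      thus "ennreal (v powr (Re q - 1) * u powr (Re p - 1)) * ennreal (c l n * u ^ l * (v powr b) ^ n)
         = ennreal (c l n) * F n y * E l \<xi>"
        using True c[of l n] uv unfolding E_def F_def u_v_def[symmetric]
        by (simp flip: ennreal_mult)
    qed
    finally show ?thesis using True by simp
  qed auto
  have "ennreal (norm (LBINT y:{b'..t}. LBINT \<xi>:{a..z}. ?f \<xi> y))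
      \<le> (\<integral>\<^sup>+y. ennreal (norm (LBINT \<xi>:{a..z}. ?f \<xi> y)) * indicator {b'..t} y \<partial>lborel)"
    by (rule ennreal_norm_set_integral_le)
  also have "\<dots> \<le> (\<integral>\<^sup>+y. (\<integral>\<^sup>+\<xi>. ennreal (norm (?f \<xi> y)) * indicator {a..z} \<xi> \<partial>lborel) * indicator {b'..t} y \<partial>lborel)"
    by (intro nn_integral_mono mult_right_mono ennreal_norm_set_integral_le) auto
  also have "\<dots> \<le> (\<integral>\<^sup>+y. (\<integral>\<^sup>+\<xi>. ennreal D * (\<Sum>l. \<Sum>n. ennreal (c l n) * F n y * E l \<xi>) \<partial>lborel) \<partial>lborel)"
  proof (intro nn_integral_mono)
    fix y
    show "(\<integral>\<^sup>+\<xi>. ennreal (norm (?f \<xi> y)) * indicator {a..z} \<xi> \<partial>lborel) * indicator {b'..t} y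
       \<le> (\<integral>\<^sup>+\<xi>. ennreal D * (\<Sum>l. \<Sum>n. ennreal (c l n) * F n y * E l \<xi>) \<partial>lborel)"
    proof (cases "y \<in> {b'..t}")
      case True
      hence "ennreal (norm (?f \<xi> y)) * indicator {a..z} \<xi>
          \<le> ennreal D * (\<Sum>l. \<Sum>n. ennreal (c l n) * F n y * E l \<xi>)" for \<xi>
        using pointwise[where \<xi> = \<xi> and y = y] by (simp only: indicator_simps mult_1_right)
      thus ?thesis using True
        by (simp only: indicator_simps mult_1_right) (rule nn_integral_mono)
    qed auto
  qed
  also have "\<dots> = ennreal D * (\<Sum>l. \<Sum>n. ennreal (c l n) * (\<integral>\<^sup>+y. F n y \<partial>lborel) * (\<integral>\<^sup>+\<xi>. E l \<xi> \<partial>lborel))"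
    by (simp add: nn_integral_cmult nn_integral_multc nn_integral_suminf)
  also have "\<dots> = ennreal D * (\<Sum>l. \<Sum>n. ennreal (c l n * ((z - a) powr (Re p + real l) / (Re p + real l))
                                  * ((t - b') powr (Re q + b * real n) / (Re q + b * real n))))"
  proof -
    have "ennreal (c l n) * (\<integral>\<^sup>+y. F n y \<partial>lborel) * (\<integral>\<^sup>+\<xi>. E l \<xi> \<partial>lborel)
       = ennreal (c l n * ((z - a) powr (Re p + real l) / (Re p + real l))
                                  * ((t - b') powr (Re q + b * real n) / (Re q + b * real n)))" for l n
    proof -
      have "Re p + real l \<ge> 0" "Re q + b * real n \<ge> 0" using p q b by auto
      thus ?thesis unfolding intE intF using c[of l n]
        by (simp add: mult_ac flip: ennreal_mult)
    qed
    thus ?thesis by simp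
  qed
  finally show ?thesis .
qed

section \<open>The modified bivariate I-Konhauser Mittag-Leffler function\<close>

context
  fixes \<gamma>1 \<gamma>2 \<gamma>3 \<gamma>4 \<gamma>5 \<gamma>6 p q \<upsilon> :: complex
begin

definition IKML_coeff :: "nat \<Rightarrow> nat \<Rightarrow> complex" where
  "IKML_coeff l n =
     ((-1) ^ l * pochhammer \<gamma>1 (2 * l) * pochhammer \<gamma>2 (l + n) * pochhammer \<gamma>3 l)
      / (pochhammer \<gamma>4 l * pochhammer \<gamma>5 l * pochhammer \<gamma>6 l
         * Gamma (p + of_nat l) * Gamma (q + \<upsilon> * of_nat n) * fact n * fact l)"

lemma IKML_eq_coeff:
  "IKML \<gamma>1 \<gamma>2 \<gamma>3 \<gamma>4 \<gamma>5 \<gamma>6 p q \<upsilon> z t = (\<Sum>l. \<Sum>n. IKML_coeff l n * z ^ l * (t powr \<upsilon>) ^ n)"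
  unfolding IKML_def IKML_coeff_def by (simp add: mult_ac)

lemma IKML_bound_eq_coeff:
  "IKML_bound \<gamma>1 \<gamma>2 \<gamma>3 \<gamma>4 \<gamma>5 \<gamma>6 p q \<upsilon> w1 w2 A B =
     ennreal (A powr Re p * B powr Re q) *
     (\<Sum>n. \<Sum>l. ennreal (norm (IKML_coeff l n) * norm (w1 * complex_of_real A) ^ l
       * norm ((w2 * complex_of_real B) powr \<upsilon>) ^ n / ((Re p + real l) * (Re q + Re \<upsilon> * real n))))"
  unfolding IKML_bound_def IKML_coeff_def
  by (simp add: norm_mult norm_divide norm_power mult_ac)

text \<open>
  Counting factorials, the numerator contributes \<open>(l!)\<^sup>4 * n!\<close> and the denominator
  \<open>(l!)\<^sup>5 * n! * \<bar>\<Gamma> (q + \<upsilon> * n)\<bar>\<close>, up to geometric factors. The two indices separate, one factor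
  \<open>1 / l!\<close> survives, and \<open>1 / \<Gamma> (q + \<upsilon> * n)\<close> provides convergence in \<open>n\<close>.
\<close>
lemma norm_IKML_coeff_le:
  assumes "Re p > 0" "Re \<upsilon> > 0"
    and "\<gamma>4 \<notin> \<int>\<^sub>\<le>\<^sub>0" "\<gamma>5 \<notin> \<int>\<^sub>\<le>\<^sub>0" "\<gamma>6 \<notin> \<int>\<^sub>\<le>\<^sub>0"
  shows "\<exists>P Q. (\<forall>l n. norm (IKML_coeff l n) \<le> P l * Q n) \<and> (\<forall>l. P l \<ge> 0) \<and> (\<forall>n. Q n \<ge> 0) \<and>
    (\<forall>X. summable (\<lambda>l. P l * X ^ l)) \<and> (\<forall>Y\<ge>0. summable (\<lambda>n. Q n * Y ^ n))"
proof -
  have p: "p \<notin> \<int>\<^sub>\<le>\<^sub>0" using assms(1) by (auto elim!: nonpos_Ints_cases)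
  hence Gp: "norm (Gamma p) > 0" by (simp add: Gamma_eq_zero_iff)
  obtain c4 c5 c6 c where pos: "c4 > 0" "c5 > 0" "c6 > 0" "c > 0"
    and lower: "\<And>l. c4 ^ l * fact l \<le> norm (pochhammer \<gamma>4 l)" "\<And>l. c5 ^ l * fact l \<le> norm (pochhammer \<gamma>5 l)"
      "\<And>l. c6 ^ l * fact l \<le> norm (pochhammer \<gamma>6 l)" "\<And>l. c ^ l * fact l \<le> norm (pochhammer p l)"
    using norm_pochhammer_ge[OF assms(3)] norm_pochhammer_ge[OF assms(4)] norm_pochhammer_ge[OF assms(5)]
      norm_pochhammer_ge[OF p] by metis
  define g1 g2 g3 where "g1 = norm \<gamma>1 + 1" "g2 = norm \<gamma>2 + 1" "g3 = norm \<gamma>3 + 1"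
  have g: "g1 > 0" "g2 > 0" "g3 > 0" by (auto simp: g1_g2_g3_def add_nonneg_pos)
  \<comment> \<open>\<open>8 = 2\<^sup>2 * 2\<close>: two factors \<open>2 ^ l\<close> come from \<open>(l + l)!\<close> and one from \<open>(l + n)!\<close>.\<close>
  define K where "K = 8 * g1 ^ 2 * g2 * g3 / (c4 * c5 * c6 * c)"
  define P where "P = (\<lambda>l. K ^ l / (fact l * norm (Gamma p)))"
  define Q where "Q = (\<lambda>n. (2 * g2) ^ n * norm (rGamma (q + \<upsilon> * of_nat n)))"
  have K: "K > 0" unfolding K_def using g pos by simp
  have "norm (IKML_coeff l n) \<le> P l * Q n" for l n
  proof -
    define N where "N = norm (pochhammer \<gamma>1 (2 * l)) * norm (pochhammer \<gamma>2 (l + n)) * norm (pochhammer \<gamma>3 l)"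
    define D where "D = norm (pochhammer \<gamma>4 l) * norm (pochhammer \<gamma>5 l) * norm (pochhammer \<gamma>6 l)
        * norm (pochhammer p l)"
    have "norm (pochhammer \<gamma>1 (2 * l)) \<le> g1 ^ (2 * l) * (2 ^ (l + l) * fact l * fact l)"
      using norm_pochhammer_le[of \<gamma>1 "2 * l"] fact_add_le[of l l] g
      by (auto simp: mult_2 g1_g2_g3_def intro!: mult_left_mono elim!: order_trans)
    moreover have "norm (pochhammer \<gamma>2 (l + n)) \<le> g2 ^ (l + n) * (2 ^ (l + n) * fact l * fact n)"
      using norm_pochhammer_le[of \<gamma>2 "l + n"] fact_add_le[of l n] g
      by (auto simp: g1_g2_g3_def intro!: mult_left_mono elim!: order_trans)
    moreover have "norm (pochhammer \<gamma>3 l) \<le> g3 ^ l * fact l"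
      using norm_pochhammer_le[of \<gamma>3 l] by (simp add: g1_g2_g3_def)
    ultimately have N: "N \<le> (g1 ^ (2 * l) * (2 ^ (l + l) * fact l * fact l))
        * (g2 ^ (l + n) * (2 ^ (l + n) * fact l * fact n)) * (g3 ^ l * fact l)" (is "_ \<le> ?N")
      unfolding N_def using g by (intro mult_mono) auto
    have D: "(c4 ^ l * fact l) * (c5 ^ l * fact l) * (c6 ^ l * fact l) * (c ^ l * fact l) \<le> D" (is "?D \<le> _")
      unfolding D_def using pos by (intro mult_mono lower) auto
    have "N / D \<le> ?N / ?D"
      using N D pos g by (intro frac_le) auto
    also have "?N / ?D = K ^ l * ((2 * g2) ^ n * fact n)"
    proof -
      have "(8 :: real) ^ l = 2 ^ l * 2 ^ l * 2 ^ l"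
        by (simp flip: power_mult_distrib)
      thus ?thesis
        unfolding K_def power_divide power_mult_distrib power_add power_mult
        using pos by (simp add: field_simps)
    qed
    finally have ND: "N / D \<le> K ^ l * ((2 * g2) ^ n * fact n)" .
    have "Gamma (p + of_nat l) = Gamma p * pochhammer p l"
      using Gp by (simp add: pochhammer_Gamma[OF p])
    hence "norm (IKML_coeff l n) = N / D * (1 / (fact l * norm (Gamma p)) * (norm (rGamma (q + \<upsilon> * of_nat n)) / fact n))"
      unfolding IKML_coeff_def N_def D_def
      by (simp add: norm_mult norm_divide norm_power rGamma_inverse_Gamma norm_inverse divide_simps)
    also have "\<dots> \<le> K ^ l * ((2 * g2) ^ n * fact n) * (1 / (fact l * norm (Gamma p)) * (norm (rGamma (q + \<upsilon> * of_nat n)) / fact n))"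
      by (intro mult_right_mono ND) auto
    also have "\<dots> = P l * Q n"
      by (simp add: P_def Q_def)
    finally show ?thesis .
  qed
  moreover have "summable (\<lambda>l. P l * X ^ l)" for X
  proof -
    have "summable (\<lambda>l. inverse (norm (Gamma p)) * (inverse (fact l) * (K * X) ^ l))"
      by (intro summable_mult summable_exp)
    thus ?thesis by (simp add: P_def power_mult_distrib field_simps)
  qed
  moreover have "summable (\<lambda>n. Q n * Y ^ n)" if "Y \<ge> 0" for Y
  proof -
    have "summable (\<lambda>n. (2 * g2 * Y) ^ n * norm (rGamma (q + \<upsilon> * of_nat n)))"
      using assms(2) g that by (intro summable_rGamma_arith_progression) auto
    thus ?thesis by (simp add: Q_def power_mult_distrib mult_ac)
  qed
  moreover have "P l \<ge> 0" "Q n \<ge> 0" for l n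
    using K g by (auto simp: P_def Q_def)
  ultimately show ?thesis by blast
qed

text \<open>
  A nonnegative real factor does not move the argument of \<open>w\<close>, so it splits off the complex power
  although the logarithm of a product is not additive in general.
\<close>
lemma norm_powr_times_of_real:
  assumes "v \<ge> 0"
  shows "norm ((w * complex_of_real v) powr c) = norm (w powr c) * v powr Re c"
  using assms powr_times_real_left[of "complex_of_real v" w c]
  by (simp add: mult.commute norm_mult norm_powr_real_powr)

text \<open>
  The continuity at \<open>v = 0\<close> comes from \<open>Re \<upsilon> > 0\<close>. As \<open>v\<close> varies, \<open>w2 * v\<close> stays on one
  ray, so the branch cut of the power is never crossed: \<open>(w2 * v) powr \<upsilon> = v powr \<upsilon> * w2 powr \<upsilon>\<close>.
\<close>
lemma IKML_continuous:
  assumes "Re p > 0" "Re \<upsilon> > 0"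
    and "\<gamma>4 \<notin> \<int>\<^sub>\<le>\<^sub>0" "\<gamma>5 \<notin> \<int>\<^sub>\<le>\<^sub>0" "\<gamma>6 \<notin> \<int>\<^sub>\<le>\<^sub>0"
  shows "continuous_on ({0..A} \<times> {0..B})
    (\<lambda>(u, v). IKML \<gamma>1 \<gamma>2 \<gamma>3 \<gamma>4 \<gamma>5 \<gamma>6 p q \<upsilon> (w1 * complex_of_real u) (w2 * complex_of_real v))"
proof -
  from norm_IKML_coeff_le[OF assms] obtain P Q
    where "(\<forall>l n. norm (IKML_coeff l n) \<le> P l * Q n) \<and> (\<forall>l. P l \<ge> 0) \<and> (\<forall>n. Q n \<ge> 0) \<and>
      (\<forall>X. summable (\<lambda>l. P l * X ^ l)) \<and> (\<forall>Y\<ge>0. summable (\<lambda>n. Q n * Y ^ n))"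
    by (elim exE)
  hence PQ: "\<And>l n. norm (IKML_coeff l n) \<le> P l * Q n" "\<And>l. P l \<ge> 0" "\<And>n. Q n \<ge> 0"
    "\<And>X. summable (\<lambda>l. P l * X ^ l)" "\<And>Y. Y \<ge> 0 \<Longrightarrow> summable (\<lambda>n. Q n * Y ^ n)"
    by simp_all
  define X Y where "X = norm w1 * A" "Y = norm (w2 powr \<upsilon>) * B powr Re \<upsilon>"
  have "continuous_on ({0..A} \<times> {0..B}) (\<lambda>x. \<Sum>l. \<Sum>n. IKML_coeff l n
      * (w1 * complex_of_real (fst x)) ^ l * ((w2 * complex_of_real (snd x)) powr \<upsilon>) ^ n)"
  proof (rule continuous_on_double_suminf)
    fix l n
    have "continuous_on ({0..A} \<times> {0..B}) (\<lambda>x. complex_of_real (snd x) powr \<upsilon>)"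
      using assms(2) by (intro continuous_on_powr_complex continuous_intros) auto
    hence "continuous_on ({0..A} \<times> {0..B}) (\<lambda>x. complex_of_real (snd x) powr \<upsilon> * w2 powr \<upsilon>)"
      by (intro continuous_on_mult continuous_on_const)
    also have "?this \<longleftrightarrow> continuous_on ({0..A} \<times> {0..B}) (\<lambda>x. (w2 * complex_of_real (snd x)) powr \<upsilon>)"
      by (intro continuous_on_cong refl) (auto simp: powr_times_real_left mult.commute[of w2])
    finally show "continuous_on ({0..A} \<times> {0..B}) (\<lambda>x. IKML_coeff l n
      * (w1 * complex_of_real (fst x)) ^ l * ((w2 * complex_of_real (snd x)) powr \<upsilon>) ^ n)"
      by (intro continuous_on_mult continuous_on_power continuous_on_const continuous_on_of_real
          continuous_on_fst continuous_on_id)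
  next
    fix l n and x :: "real \<times> real" assume x: "x \<in> {0..A} \<times> {0..B}"
    have "norm (IKML_coeff l n) * norm (w1 * complex_of_real (fst x)) ^ l * norm ((w2 * complex_of_real (snd x)) powr \<upsilon>) ^ n
       \<le> (P l * Q n) * X ^ l * Y ^ n"
      unfolding X_Y_def
    proof (intro mult_mono PQ power_mono)
      show "norm (w1 * complex_of_real (fst x)) \<le> norm w1 * A"
        using x by (auto simp: norm_mult intro!: mult_left_mono)
      show "norm ((w2 * complex_of_real (snd x)) powr \<upsilon>) \<le> norm (w2 powr \<upsilon>) * B powr Re \<upsilon>"
        using x assms(2) by (auto simp: norm_powr_times_of_real intro!: mult_left_mono powr_mono2)
    qed (use x PQ in \<open>auto intro!: mult_nonneg_nonneg zero_le_power\<close>)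
    thus "norm (IKML_coeff l n * (w1 * complex_of_real (fst x)) ^ l * ((w2 * complex_of_real (snd x)) powr \<upsilon>) ^ n)
       \<le> (P l * X ^ l) * (Q n * Y ^ n)"
      by (simp add: norm_mult norm_power mult_ac)
  qed (use PQ in \<open>auto simp: X_Y_def\<close>)
  thus ?thesis by (simp add: IKML_eq_coeff case_prod_beta)
qed

lemma IKML_bound_finite:
  assumes "Re p > 0" "Re q > 0" "Re \<upsilon> > 0"
    and "\<gamma>4 \<notin> \<int>\<^sub>\<le>\<^sub>0" "\<gamma>5 \<notin> \<int>\<^sub>\<le>\<^sub>0" "\<gamma>6 \<notin> \<int>\<^sub>\<le>\<^sub>0"
  shows "IKML_bound \<gamma>1 \<gamma>2 \<gamma>3 \<gamma>4 \<gamma>5 \<gamma>6 p q \<upsilon> w1 w2 A B < \<infinity>"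
proof -
  from norm_IKML_coeff_le[OF assms(1,3-)] obtain P Q
    where "(\<forall>l n. norm (IKML_coeff l n) \<le> P l * Q n) \<and> (\<forall>l. P l \<ge> 0) \<and> (\<forall>n. Q n \<ge> 0) \<and>
      (\<forall>X. summable (\<lambda>l. P l * X ^ l)) \<and> (\<forall>Y\<ge>0. summable (\<lambda>n. Q n * Y ^ n))"
    by (elim exE)
  hence PQ: "\<And>l n. norm (IKML_coeff l n) \<le> P l * Q n" "\<And>l. P l \<ge> 0" "\<And>n. Q n \<ge> 0"
    "\<And>X. summable (\<lambda>l. P l * X ^ l)" "\<And>Y. Y \<ge> 0 \<Longrightarrow> summable (\<lambda>n. Q n * Y ^ n)"
    by simp_all
  define X Y where "X = norm (w1 * complex_of_real A)" "Y = norm ((w2 * complex_of_real B) powr \<upsilon>)"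
  have XY: "X \<ge> 0" "Y \<ge> 0" by (auto simp: X_Y_def)
  have "(\<Sum>n. \<Sum>l. ennreal (norm (IKML_coeff l n) * X ^ l * Y ^ n / ((Re p + real l) * (Re q + Re \<upsilon> * real n))))
      \<le> (\<Sum>n. \<Sum>l. ennreal (Q n * Y ^ n / Re q) * ennreal (P l * X ^ l / Re p))"
  proof (intro suminf_le summableI)
    fix l n
    have "norm (IKML_coeff l n) * X ^ l * Y ^ n / ((Re p + real l) * (Re q + Re \<upsilon> * real n))
        \<le> (P l * Q n) * X ^ l * Y ^ n / (Re p * Re q)"
      using assms XY PQ by (intro frac_le mult_mono) auto
    also have "\<dots> = (Q n * Y ^ n / Re q) * (P l * X ^ l / Re p)"
      by (simp add: mult_ac)
    finally have "ennreal (norm (IKML_coeff l n) * X ^ l * Y ^ n / ((Re p + real l) * (Re q + Re \<upsilon> * real n)))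
        \<le> ennreal ((Q n * Y ^ n / Re q) * (P l * X ^ l / Re p))"
      by (rule ennreal_leI)
    also have "\<dots> = ennreal (Q n * Y ^ n / Re q) * ennreal (P l * X ^ l / Re p)"
      using assms XY PQ by (intro ennreal_mult) auto
    finally show "ennreal (norm (IKML_coeff l n) * X ^ l * Y ^ n / ((Re p + real l) * (Re q + Re \<upsilon> * real n)))
        \<le> ennreal (Q n * Y ^ n / Re q) * ennreal (P l * X ^ l / Re p)" .
  qed
  also have "\<dots> = (\<Sum>n. ennreal (Q n * Y ^ n / Re q)) * (\<Sum>l. ennreal (P l * X ^ l / Re p))"
    by simp
  also have "\<dots> < \<infinity>"
  proof -
    have "(\<Sum>n. ennreal (Q n * Y ^ n / Re q)) \<noteq> top" "(\<Sum>l. ennreal (P l * X ^ l / Re p)) \<noteq> top"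
      using assms XY PQ by (simp_all add: ennreal_suminf_neq_top summable_divide)
    thus ?thesis by (simp add: ennreal_mult_less_top less_top)
  qed
  finally show ?thesis
    unfolding IKML_bound_eq_coeff X_Y_def by (simp add: ennreal_mult_less_top)
qed

lemma norm_IKML_le:
  assumes "u \<ge> 0" "v \<ge> 0"
  shows "ennreal (norm (IKML \<gamma>1 \<gamma>2 \<gamma>3 \<gamma>4 \<gamma>5 \<gamma>6 p q \<upsilon> (w1 * complex_of_real u) (w2 * complex_of_real v)))
    \<le> (\<Sum>l. \<Sum>n. ennreal (norm (IKML_coeff l n) * norm w1 ^ l * norm (w2 powr \<upsilon>) ^ n * u ^ l * (v powr Re \<upsilon>) ^ n))"
proof -
  let ?a = "\<lambda>l n. IKML_coeff l n * (w1 * complex_of_real u) ^ l * ((w2 * complex_of_real v) powr \<upsilon>) ^ n"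
  have "ennreal (norm (\<Sum>l. \<Sum>n. ?a l n)) \<le> (\<Sum>l. ennreal (norm (\<Sum>n. ?a l n)))"
    by (rule ennreal_norm_suminf_le)
  also have "\<dots> \<le> (\<Sum>l. \<Sum>n. ennreal (norm (?a l n)))"
    by (intro suminf_le summableI ennreal_norm_suminf_le)
  finally show ?thesis
    using assms by (simp add: IKML_eq_coeff norm_mult norm_power norm_powr_times_of_real power_mult_distrib mult_ac)
qed

text \<open>
  The estimate at a single point \<open>(z, t)\<close>; each term increases when \<open>z - a1\<close> and \<open>t - b1\<close> are replaced
  by the sides of the rectangle.
\<close>
lemma norm_IKML_op_le:
  fixes w1 w2 :: complex
  assumes "Re p > 0" "Re q > 0" "Re \<upsilon> > 0"
    and z: "a1 \<le> z" "z \<le> a2" and t: "b1 \<le> t" "t \<le> b2"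
    and d: "\<And>x. x \<in> {a1..a2} \<times> {b1..b2} \<Longrightarrow> norm (d x) \<le> D"
  shows "ennreal (norm (IKML_op \<gamma>1 \<gamma>2 \<gamma>3 \<gamma>4 \<gamma>5 \<gamma>6 p q \<upsilon> w1 w2 a1 b1 d (z, t)))
    \<le> IKML_bound \<gamma>1 \<gamma>2 \<gamma>3 \<gamma>4 \<gamma>5 \<gamma>6 p q \<upsilon> w1 w2 (a2 - a1) (b2 - b1) * ennreal D"
proof -
  define A B where "A = a2 - a1" "B = b2 - b1"
  have AB: "A \<ge> 0" "B \<ge> 0" "z - a1 \<le> A" "t - b1 \<le> B" using z t by (auto simp: A_B_def)
  let ?c = "\<lambda>l n. norm (IKML_coeff l n) * norm w1 ^ l * norm (w2 powr \<upsilon>) ^ n"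
  let ?s = "\<lambda>l n. ?c l n * ((z - a1) powr (Re p + real l) / (Re p + real l))
                * ((t - b1) powr (Re q + Re \<upsilon> * real n) / (Re q + Re \<upsilon> * real n))"
  let ?m = "\<lambda>l n. norm (IKML_coeff l n) * norm (w1 * complex_of_real A) ^ l
       * norm ((w2 * complex_of_real B) powr \<upsilon>) ^ n / ((Re p + real l) * (Re q + Re \<upsilon> * real n))"
  have *: "ennreal (norm (IKML_op \<gamma>1 \<gamma>2 \<gamma>3 \<gamma>4 \<gamma>5 \<gamma>6 p q \<upsilon> w1 w2 a1 b1 d (z, t)))
      \<le> ennreal D * (\<Sum>l. \<Sum>n. ennreal (?s l n))"
    unfolding IKML_op_def IKML_integrand_def prod.case
    using assms
    by (intro double_powr_kernel_bound[where \<Psi> = "\<lambda>u v. IKML \<gamma>1 \<gamma>2 \<gamma>3 \<gamma>4 \<gamma>5 \<gamma>6 p q \<upsilon>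
          (w1 * complex_of_real u) (w2 * complex_of_real v)"] norm_IKML_le d) auto
  have "(\<Sum>l. \<Sum>n. ennreal (?s l n)) \<le> (\<Sum>l. \<Sum>n. ennreal (A powr Re p * B powr Re q) * ennreal (?m l n))"
  proof (intro suminf_le summableI)
    fix l n
    have pos: "Re p + real l > 0" "Re q + Re \<upsilon> * real n > 0"
      using assms by (auto intro: add_pos_nonneg)
    have "?s l n \<le> ?c l n * (A powr (Re p + real l) / (Re p + real l))
                * (B powr (Re q + Re \<upsilon> * real n) / (Re q + Re \<upsilon> * real n))"
      using pos z t AB by (intro mult_mono divide_right_mono powr_mono2) auto
    also have "\<dots> = A powr Re p * B powr Re q * ?m l n"
      using AB by (simp add: norm_powr_times_of_real norm_mult power_mult_distrib
          flip: powr_add_of_nat powr_add_mult_of_nat)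
    finally have "ennreal (?s l n) \<le> ennreal (A powr Re p * B powr Re q * ?m l n)"
      by (rule ennreal_leI)
    also have "\<dots> = ennreal (A powr Re p * B powr Re q) * ennreal (?m l n)"
      using pos by (intro ennreal_mult) auto
    finally show "ennreal (?s l n) \<le> ennreal (A powr Re p * B powr Re q) * ennreal (?m l n)" .
  qed
  also have "(\<Sum>l. \<Sum>n. ennreal (A powr Re p * B powr Re q) * ennreal (?m l n))
      = ennreal (A powr Re p * B powr Re q) * (\<Sum>l. \<Sum>n. ennreal (?m l n))"
    by simp
  \<comment> \<open>The function sums over \<open>n\<close> first, the constant over \<open>l\<close> first.\<close>
  also have "(\<Sum>l. \<Sum>n. ennreal (?m l n)) = (\<Sum>n. \<Sum>l. ennreal (?m l n))"
    by (rule ennreal_suminf_swap)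
  finally have "(\<Sum>l. \<Sum>n. ennreal (?s l n))
      \<le> IKML_bound \<gamma>1 \<gamma>2 \<gamma>3 \<gamma>4 \<gamma>5 \<gamma>6 p q \<upsilon> w1 w2 (a2 - a1) (b2 - b1)"
    unfolding IKML_bound_eq_coeff A_B_def .
  hence "ennreal D * (\<Sum>l. \<Sum>n. ennreal (?s l n))
      \<le> ennreal D * IKML_bound \<gamma>1 \<gamma>2 \<gamma>3 \<gamma>4 \<gamma>5 \<gamma>6 p q \<upsilon> w1 w2 (a2 - a1) (b2 - b1)"
    by (rule mult_left_mono) simp
  with * show ?thesis
    by (subst mult.commute) (rule order_trans)
qed

end

section \<open>Boundedness of the integral operator\<close>

theorem theorem57:
  fixes \<gamma>1 \<gamma>2 \<gamma>3 \<gamma>4 \<gamma>5 \<gamma>6 p q \<upsilon> w1 w2 :: complex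
    and a1 a2 b1 b2 :: real
  assumes "Re p > 0" "Re q > 0" "Re \<upsilon> > 0"
    and "\<gamma>4 \<notin> \<int>\<^sub>\<le>\<^sub>0" "\<gamma>5 \<notin> \<int>\<^sub>\<le>\<^sub>0" "\<gamma>6 \<notin> \<int>\<^sub>\<le>\<^sub>0"
    and "a1 \<le> a2" "b1 \<le> b2"
  defines "R \<equiv> {a1..a2} \<times> {b1..b2}"
    and "M \<equiv> IKML_bound \<gamma>1 \<gamma>2 \<gamma>3 \<gamma>4 \<gamma>5 \<gamma>6 p q \<upsilon> w1 w2 (a2 - a1) (b2 - b1)"
    and "f \<equiv> IKML_integrand \<gamma>1 \<gamma>2 \<gamma>3 \<gamma>4 \<gamma>5 \<gamma>6 p q \<upsilon> w1 w2"
    and "T \<equiv> IKML_op \<gamma>1 \<gamma>2 \<gamma>3 \<gamma>4 \<gamma>5 \<gamma>6 p q \<upsilon> w1 w2 a1 b1"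
  shows "M < \<infinity> \<and>
    (\<forall>d. continuous_on R d \<longrightarrow>
       (\<forall>(z, t)\<in>R.
          (\<forall>y\<in>{b1..t}. set_integrable lborel {a1..z} (\<lambda>\<xi>. f d z t y \<xi>)) \<and>
          set_integrable lborel {b1..t} (\<lambda>y. LBINT \<xi>:{a1..z}. f d z t y \<xi>)) \<and>
       continuous_on R (T d) \<and>
       ennreal (normC R (T d)) \<le> M * ennreal (normC R d))"
proof (intro conjI allI impI)
  show "M < \<infinity>" unfolding M_def by (rule IKML_bound_finite[OF assms(1-6)])
next
  fix d :: "real \<times> real \<Rightarrow> complex" assume d: "continuous_on R d"
  let ?\<Psi> = "\<lambda>u v. IKML \<gamma>1 \<gamma>2 \<gamma>3 \<gamma>4 \<gamma>5 \<gamma>6 p q \<upsilon> (w1 * complex_of_real u) (w2 * complex_of_real v)"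
  have R: "compact R" "R \<noteq> {}" using assms(7,8) by (auto simp: R_def intro: compact_Times)
  have \<Psi>: "continuous_on ({0..a2 - a1} \<times> {0..b2 - b1}) (\<lambda>(u, v). ?\<Psi> u v)"
    by (rule IKML_continuous[OF assms(1,3-6)])
  show "\<forall>(z, t)\<in>R.
          (\<forall>y\<in>{b1..t}. set_integrable lborel {a1..z} (\<lambda>\<xi>. f d z t y \<xi>)) \<and>
          set_integrable lborel {b1..t} (\<lambda>y. LBINT \<xi>:{a1..z}. f d z t y \<xi>)"
    unfolding f_def IKML_integrand_def R_def
    using double_powr_kernel_integrable[OF assms(1,2) \<Psi> d[unfolded R_def]] by blast
  show cont: "continuous_on R (T d)"
    unfolding T_def IKML_op_def IKML_integrand_def R_def
    by (rule double_powr_kernel_continuous[OF assms(1,2) \<Psi> d[unfolded R_def]])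
  have D: "norm (d x) \<le> normC R d" if "x \<in> R" for x
    using normC_max[OF R d] that by auto
  obtain z t where zt: "(z, t) \<in> R" "normC R (T d) = norm (T d (z, t))"
    using normC_max[OF R cont] by auto
  show "ennreal (normC R (T d)) \<le> M * ennreal (normC R d)"
    unfolding zt(2) unfolding T_def M_def
    using zt(1) D assms(1-3) unfolding R_def
    by (intro norm_IKML_op_le) auto
qed

end
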